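(* Let $A$ be an alphabet and let $X \subseteq A^+$ be a uniquely decipherable code. Then $X$ is a maximal uniquely decipherable code if and only if the submonoid $X^*$ of $A^*$ is full.
   Context: $A^*$ is the monoid of finite words over $A$ under concatenation, with empty word $1$; $A^+ = A^*\setminus\{1\}$. A code is any subset $X \subseteq A^+$; $X^*$ is the submonoid of $A^*$ generated by $X$. A code $X$ is uniquely decipherable (UD) if $x_1\cdots x_n = y_1\cdots y_m$ with all $x_i,y_j\in X$ implies $n=m$ and $x_i=y_i$ for all $i$. A UD code $X\subseteq A^+$ is a maximal UD code if it is not properly contained in any other UD code over $A$. Free product: let $N$ be a monoid generated by submonoids $M$ and $L$. An expression $m_1 m_2\cdots m_r$ ($r\ge 0$) of an element of $N$ is in reduced form with respect to $M, L$ if each $m_i \neq 1$, each $m_i$ belongs to $M$ or $L$, and consecutive factors are taken from different ones of the two submonoids. One writes $N = M * L$ if $N$ is generated by $M\cup L$ and every element of $N$ has a unique expression in reduced form with respect to $M, L$ ($L$ may be trivial). For submonoids $M, N$ of $A^*$, $M \preceq N$ means that there is a submonoid $L \subseteq A^*$ with $N = M * L$. This is a partial order on the submonoids of $A^*$. A submonoid of $A^*$ is full if it is maximal with respect to $\preceq$. *)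

theory Defs
  imports "HOL-Algebra.Group" HOL.Hull
begin

definition word_monoid :: "'a set \<Rightarrow> 'a list monoid" where
  "word_monoid A = \<lparr>carrier = lists A, monoid.mult = (@), one = []\<rparr>"

lemma word_monoid_simps [simp]:
  "carrier (word_monoid A) = lists A"
  "x \<otimes>\<^bsub>word_monoid A\<^esub> y = x @ y"
  "\<one>\<^bsub>word_monoid A\<^esub> = []"
  by (simp_all add: word_monoid_def)

lemma monoid_word_monoid: "Group.monoid (word_monoid A)"
  by (rule monoidI) auto

definition gen_submonoid :: "('a, 'b) monoid_scheme \<Rightarrow> 'a set \<Rightarrow> 'a set" where
  "gen_submonoid G S = (\<lambda>H. submonoid H G) hull S"

definition code :: "'a set \<Rightarrow> 'a list set \<Rightarrow> bool" where
  "code A X \<longleftrightarrow> X \<subseteq> lists A - {[]}"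

definition ud_code :: "'a set \<Rightarrow> 'a list set \<Rightarrow> bool" where
  "ud_code A X \<longleftrightarrow> code A X \<and>
     (\<forall>xs \<in> lists X. \<forall>ys \<in> lists X. concat xs = concat ys \<longrightarrow> xs = ys)"

definition maximal_ud_code :: "'a set \<Rightarrow> 'a list set \<Rightarrow> bool" where
  "maximal_ud_code A X \<longleftrightarrow> ud_code A X \<and> \<not> (\<exists>Y. ud_code A Y \<and> X \<subset> Y)"

(* The function c records from which submonoid each factor is taken (True for M, False for L);
   this is needed because a factor may lie in both. *)
definition reduced_form ::
    "('a, 'b) monoid_scheme \<Rightarrow> 'a set \<Rightarrow> 'a set \<Rightarrow> 'a list \<Rightarrow> bool" where
  "reduced_form G M L ms \<longleftrightarrow> \<one>\<^bsub>G\<^esub> \<notin> set ms \<and>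
     (\<exists>c :: nat \<Rightarrow> bool.
        (\<forall>i < length ms. ms ! i \<in> (if c i then M else L)) \<and>
        (\<forall>i. Suc i < length ms \<longrightarrow> c i \<noteq> c (Suc i)))"

(* N = M * L, for submonoids N, M, L of an ambient monoid G. Uniqueness is uniqueness of the
   sequence of factors. *)
definition is_free_product ::
    "('a, 'b) monoid_scheme \<Rightarrow> 'a set \<Rightarrow> 'a set \<Rightarrow> 'a set \<Rightarrow> bool" where
  "is_free_product G N M L \<longleftrightarrow>
     submonoid N G \<and> submonoid M G \<and> submonoid L G \<and>
     N = gen_submonoid G (M \<union> L) \<and>
     (\<forall>x \<in> N. \<exists>!ms. reduced_form G M L ms \<and> foldr (\<otimes>\<^bsub>G\<^esub>) ms \<one>\<^bsub>G\<^esub> = x)"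

definition free_factor :: "('a, 'b) monoid_scheme \<Rightarrow> 'a set \<Rightarrow> 'a set \<Rightarrow> bool" where
  "free_factor G M N \<longleftrightarrow> (\<exists>L. is_free_product G N M L)"

definition full_submonoid :: "('a, 'b) monoid_scheme \<Rightarrow> 'a set \<Rightarrow> bool" where
  "full_submonoid G M \<longleftrightarrow> submonoid M G \<and>
     (\<forall>N. submonoid N G \<and> free_factor G M N \<longrightarrow> N = M)"

end

theory Submission
  imports Defs
begin

text \<open>Splitting a sequence of code words from \<open>X \<union> Z\<close> into its maximal runs inside \<open>X\<close> and
  inside \<open>Z\<close> and multiplying out each run yields a reduced form with respect to \<open>X\<^sup>*\<close> and \<open>Z\<^sup>*\<close>.
  Hence, if a uniquely decipherable \<open>Y\<close> properly contains \<open>X\<close>, then \<open>Y\<^sup>*\<close> is the free product of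
  \<open>X\<^sup>*\<close> and \<open>(Y - X)\<^sup>*\<close>, so \<open>X\<^sup>*\<close> is not full. Conversely, if \<open>X\<^sup>*\<close> has a nontrivial free
  complement \<open>L\<close>, then adjoining to \<open>X\<close> any single nonempty word of \<open>L\<close> preserves unique
  decipherability: the reduced form recovers the runs, and each run recovers its code words.\<close>

section \<open>Submonoids of the word monoid and their generators\<close>

lemma mult_word_monoid [simp]: "mult (word_monoid A) = (@)"
  by (simp add: word_monoid_def)

lemma foldr_append_Nil [simp]: "foldr (@) xss [] = concat xss"
  by (simp add: concat_conv_foldr)

lemma concat_map_concat: "concat (map concat xsss) = concat (concat xsss)"
  by (induction xsss) auto

lemma submonoid_word_monoid_iff:
  "submonoid H (word_monoid A) \<longleftrightarrow>
    H \<subseteq> lists A \<and> [] \<in> H \<and> (\<forall>x \<in> H. \<forall>y \<in> H. x @ y \<in> H)"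
  by (auto simp: submonoid_def)

lemma concat_in_submonoid:
  assumes "submonoid H (word_monoid A)" and "xs \<in> lists H"
  shows "concat xs \<in> H"
  using assms(2,1) by induction (auto simp: submonoid_word_monoid_iff)

lemma submonoid_concat_lists:
  assumes "X \<subseteq> lists A"
  shows "submonoid (concat ` lists X) (word_monoid A)"
  unfolding submonoid_word_monoid_iff
proof (intro conjI ballI)
  show "concat ` lists X \<subseteq> lists A"
    using assms by fastforce
  show "[] \<in> concat ` lists X"
    by (rule image_eqI[of _ _ "[]"]) auto
  fix x y assume "x \<in> concat ` lists X" "y \<in> concat ` lists X"
  then obtain xs ys where "xs \<in> lists X" "ys \<in> lists X" "x = concat xs" "y = concat ys"
    by blast
  then show "x @ y \<in> concat ` lists X"
    by (intro image_eqI[of _ _ "xs @ ys"]) auto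
qed

lemma gen_submonoid_word_monoid:
  assumes "X \<subseteq> lists A"
  shows "gen_submonoid (word_monoid A) X = concat ` lists X"
  unfolding gen_submonoid_def
proof (rule hull_unique)
  show "X \<subseteq> concat ` lists X"
    by (auto intro!: image_eqI[of _ _ "[x]" for x])
  show "submonoid (concat ` lists X) (word_monoid A)"
    using assms by (rule submonoid_concat_lists)
  show "concat ` lists X \<subseteq> H" if "X \<subseteq> H" "submonoid H (word_monoid A)" for H
    using that concat_in_submonoid lists_mono by blast
qed

lemma gen_submonoid_Un:
  "gen_submonoid G (gen_submonoid G S \<union> gen_submonoid G T) = gen_submonoid G (S \<union> T)"
  unfolding gen_submonoid_def by (metis hull_Un_left hull_Un_right)

section \<open>Decomposition of a list into maximal runs\<close>

text \<open>The kind of a run is read off from its head, which is legitimate because runs are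
  nonempty and \<open>P\<close> is constant on each. Together with \<open>concat rs = ys\<close>
  this characterizes the value of \<open>runs P ys\<close>.\<close>

definition runs_wrt :: "('a \<Rightarrow> bool) \<Rightarrow> 'a list list \<Rightarrow> bool" where
  "runs_wrt P rs \<longleftrightarrow> [] \<notin> set rs \<and> (\<forall>r \<in> set rs. \<forall>y \<in> set r. P y = P (hd r)) \<and>
     successively (\<lambda>r s. P (hd r) \<noteq> P (hd s)) rs"

fun runs :: "('a \<Rightarrow> bool) \<Rightarrow> 'a list \<Rightarrow> 'a list list" where
  "runs P [] = []"
| "runs P (y # ys) = (case runs P ys of
      [] \<Rightarrow> [[y]]
    | r # rs \<Rightarrow> if P (hd r) = P y then (y # r) # rs else [y] # r # rs)"

lemma concat_runs [simp]: "concat (runs P ys) = ys"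
  by (induction ys) (auto split: list.splits)

lemma runs_wrt_runs: "runs_wrt P (runs P ys)"
proof (induction ys)
  case (Cons y ys)
  then show ?case
    by (cases "runs P ys") (auto simp: runs_wrt_def successively_Cons)
qed (simp add: runs_wrt_def)

text \<open>The last element of \<open>r\<close> opens a new run because the first run of
  \<open>ys\<close>, if any, is of the other kind; the earlier elements are then merged into it from
  right to left.\<close>

lemma runs_append:
  assumes "r \<noteq> []" and "\<forall>y \<in> set r. P y = P (hd r)"
    and "runs P ys = [] \<or> P (hd (hd (runs P ys))) \<noteq> P (hd r)"
  shows "runs P (r @ ys) = r # runs P ys"
  using assms
proof (induction r)
  case (Cons y r)
  show ?case
  proof (cases "r = []")
    case True
    then show ?thesis using Cons.prems by (auto split: list.splits)
  next
    case False
    have eq: "P z = P y" if "z \<in> set (y # r)" for z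
      using Cons.prems(2) that by (metis list.sel(1))
    then have hd: "P (hd r) = P y"
      using False by (metis hd_in_set list.set_intros(2))
    have "runs P (r @ ys) = r # runs P ys"
    proof (rule Cons.IH)
      show "\<forall>z \<in> set r. P z = P (hd r)"
        unfolding hd using eq by (metis list.set_intros(2))
      show "runs P ys = [] \<or> P (hd (hd (runs P ys))) \<noteq> P (hd r)"
        unfolding hd using Cons.prems(3) by simp
    qed (rule False)
    then show ?thesis
      using hd by simp
  qed
qed simp

text \<open>This is the uniqueness of the decomposition into runs. It later identifies an arbitrary
  reduced form with the one built by \<open>runs\<close>.\<close>

lemma runs_concat: "runs_wrt P rs \<Longrightarrow> runs P (concat rs) = rs"
proof (induction rs)
  case (Cons r rs)
  then have "runs P (concat rs) = rs"
    by (cases rs) (auto simp: runs_wrt_def)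
  moreover have "runs P (r @ concat rs) = r # runs P (concat rs)"
    using Cons.prems calculation
    by (intro runs_append) (auto simp: runs_wrt_def successively_Cons)
  ultimately show ?case
    by simp
qed simp

section \<open>Reduced forms obtained from runs\<close>

text \<open>A factor other than the unit lies in only one of \<open>M\<close> and \<open>L\<close>,
  so the choice function \<open>c\<close> is forced to be membership in \<open>M\<close> and can be
  eliminated.\<close>

lemma reduced_form_iff:
  assumes "M \<inter> L \<subseteq> {\<one>\<^bsub>G\<^esub>}"
  shows "reduced_form G M L ms \<longleftrightarrow> \<one>\<^bsub>G\<^esub> \<notin> set ms \<and> set ms \<subseteq> M \<union> L \<and>
    successively (\<lambda>x y. (x \<in> M) \<noteq> (y \<in> M)) ms"
proof
  assume "reduced_form G M L ms"
  then obtain c where one: "\<one>\<^bsub>G\<^esub> \<notin> set ms"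
    and c: "\<And>i. i < length ms \<Longrightarrow> ms ! i \<in> (if c i then M else L)"
    and alt: "\<And>i. Suc i < length ms \<Longrightarrow> c i \<noteq> c (Suc i)"
    unfolding reduced_form_def by blast
  have "ms ! i \<in> M \<longleftrightarrow> c i" if "i < length ms" for i
    using c[OF that] nth_mem[OF that] one assms by (auto split: if_splits)
  moreover have "set ms \<subseteq> M \<union> L"
    using c by (force simp: in_set_conv_nth split: if_splits)
  ultimately show "\<one>\<^bsub>G\<^esub> \<notin> set ms \<and> set ms \<subseteq> M \<union> L \<and>
      successively (\<lambda>x y. (x \<in> M) \<noteq> (y \<in> M)) ms"
    using one alt by (simp add: successively_conv_nth)
next
  assume *: "\<one>\<^bsub>G\<^esub> \<notin> set ms \<and> set ms \<subseteq> M \<union> L \<and> successively (\<lambda>x y. (x \<in> M) \<noteq> (y \<in> M)) ms"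
  then show "reduced_form G M L ms"
    unfolding reduced_form_def
    by (intro conjI exI[of _ "\<lambda>i. ms ! i \<in> M"]) (auto simp: successively_conv_nth dest: nth_mem)
qed

text \<open>The product of a run is nonempty, and since \<open>M\<close> and \<open>L\<close> meet
  trivially it lies in \<open>M\<close> exactly when the head of the run lies in \<open>X\<close>;
  so alternating runs give alternating factors. \<open>M\<close> and \<open>L\<close> may be larger
  than the submonoids generated by \<open>X\<close> and \<open>Z\<close>, as happens when
  \<open>Z\<close> is a single word of \<open>L\<close>.\<close>

lemma reduced_form_map_concat:
  assumes M: "submonoid M (word_monoid A)" and L: "submonoid L (word_monoid A)"
    and triv: "M \<inter> L \<subseteq> {[]}"
    and XZ: "X \<subseteq> M - {[]}" "Z \<subseteq> L - {[]}"
    and rs: "runs_wrt (\<lambda>y. y \<in> X) rs" "set rs \<subseteq> lists (X \<union> Z)"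
  shows "reduced_form (word_monoid A) M L (map concat rs)"
proof -
  have *: "concat r \<noteq> [] \<and> concat r \<in> M \<union> L \<and> (concat r \<in> M \<longleftrightarrow> hd r \<in> X)"
    if "r \<in> set rs" for r
  proof -
    have ne: "r \<noteq> []" and hd: "\<forall>y \<in> set r. y \<in> X \<longleftrightarrow> hd r \<in> X" and r: "r \<in> lists (X \<union> Z)"
      using rs that by (auto simp: runs_wrt_def)
    have "hd r \<in> X \<union> Z"
      using in_listsD[OF r] hd_in_set[OF ne] by blast
    then have "hd r \<noteq> []"
      using XZ by blast
    then have "concat r \<noteq> []"
      using ne by (metis concat_eq_Nil_conv hd_in_set)
    moreover have "concat r \<in> M" if "hd r \<in> X"
      using M by (rule concat_in_submonoid) (use hd that XZ in auto)
    moreover have "concat r \<in> L" if "hd r \<notin> X"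
      using L by (rule concat_in_submonoid) (use hd that XZ r in auto)
    ultimately show ?thesis
      using triv by blast
  qed
  have "successively (\<lambda>r s. (concat r \<in> M) \<noteq> (concat s \<in> M)) rs"
    using rs(1) * by (auto simp: runs_wrt_def intro: successively_mono)
  moreover have "[] \<notin> set (map concat rs)" "set (map concat rs) \<subseteq> M \<union> L"
    using * by (metis imageE list.set_map) (use * in auto)
  ultimately show ?thesis
    using triv by (simp add: reduced_form_iff successively_map)
qed

text \<open>If \<open>m\<close> lies in both factors, \<open>m m\<close> has the two reduced forms \<open>[m m]\<close> and \<open>[m, m]\<close>.\<close>

lemma is_free_product_Int:
  assumes "is_free_product (word_monoid A) N M L"
  shows "M \<inter> L \<subseteq> {[]}"
proof
  fix m assume m: "m \<in> M \<inter> L"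
  have sub: "submonoid N (word_monoid A)" "submonoid M (word_monoid A)"
    and N: "N = gen_submonoid (word_monoid A) (M \<union> L)"
    and unique: "\<forall>x \<in> N. \<exists>!ms. reduced_form (word_monoid A) M L ms \<and> concat ms = x"
    using assms by (auto simp: is_free_product_def)
  have mm: "m @ m \<in> M"
    using m sub by (auto simp: submonoid_word_monoid_iff)
  have "M \<subseteq> N"
    unfolding N gen_submonoid_def by (meson hull_subset le_supE)
  show "m \<in> {[]}"
  proof (rule ccontr)
    assume "m \<notin> {[]}"
    then have "reduced_form (word_monoid A) M L [m @ m]"
      using mm by (auto simp: reduced_form_def intro!: exI[of _ "\<lambda>_. True"])
    \<comment> \<open>With \<open>even\<close> as choice function, position 0 counts as taken from
      \<open>M\<close> and position 1 from \<open>L\<close>.\<close>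
    moreover have "reduced_form (word_monoid A) M L [m, m]"
      using m \<open>m \<notin> {[]}\<close>
      by (auto simp: reduced_form_def less_Suc_eq intro!: exI[of _ even])
    moreover have "concat [m @ m] = m @ m" "concat [m, m] = m @ m"
      by simp_all
    ultimately have "[m @ m] = [m, m]"
      using unique mm \<open>M \<subseteq> N\<close> by blast
    then show False by simp
  qed
qed

section \<open>Unique decipherability and free products\<close>

text \<open>The run products of two factorizations of one word are reduced forms of the same element
  of \<open>N\<close>, hence agree factor by factor. It remains to see that a run is determined by
  its product.\<close>

lemma ud_code_Un:
  assumes free: "is_free_product (word_monoid A) N M L"
    and X: "ud_code A X" "X \<subseteq> M" and Z: "ud_code A Z" "Z \<subseteq> L"
  shows "ud_code A (X \<union> Z)"
  unfolding ud_code_def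
proof (intro conjI ballI impI)
  show "code A (X \<union> Z)"
    using X(1) Z(1) by (auto simp: ud_code_def code_def)
  have M: "submonoid M (word_monoid A)" and L: "submonoid L (word_monoid A)"
    and N: "submonoid N (word_monoid A)" "N = gen_submonoid (word_monoid A) (M \<union> L)"
    and unique: "\<forall>x \<in> N. \<exists>!ms. reduced_form (word_monoid A) M L ms \<and> concat ms = x"
    using free by (auto simp: is_free_product_def)
  have triv: "M \<inter> L \<subseteq> {[]}"
    using free by (rule is_free_product_Int)
  have XM: "X \<subseteq> M - {[]}" and ZL: "Z \<subseteq> L - {[]}"
    using X Z by (auto simp: ud_code_def code_def)
  have "M \<union> L \<subseteq> N"
    unfolding N(2) gen_submonoid_def by (rule hull_subset)
  fix xs ys assume xs: "xs \<in> lists (X \<union> Z)" and ys: "ys \<in> lists (X \<union> Z)"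
    and eq: "concat xs = concat ys"
  let ?P = "\<lambda>y. y \<in> X"
  have in_lists: "set (runs ?P zs) \<subseteq> lists (X \<union> Z)" if "zs \<in> lists (X \<union> Z)" for zs
  proof -
    have "concat (runs ?P zs) \<in> lists (X \<union> Z)"
      using that by simp
    then show ?thesis by (auto simp del: concat_runs)
  qed
  have red: "reduced_form (word_monoid A) M L (map concat (runs ?P zs))"
    if "zs \<in> lists (X \<union> Z)" for zs
    using reduced_form_map_concat[OF M L triv XM ZL runs_wrt_runs in_lists[OF that]] .
  have conc: "concat (map concat (runs ?P zs)) = concat zs" for zs :: "'a list list"
    by (simp add: concat_map_concat)
  have "concat xs \<in> N"
    using N(1) by (rule concat_in_submonoid) (use xs XM ZL \<open>M \<union> L \<subseteq> N\<close> in blast)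
  then have maps: "map concat (runs ?P xs) = map concat (runs ?P ys)"
    using unique red[OF xs] red[OF ys] conc[of xs] conc[of ys] eq by metis
  \<comment> \<open>A nonempty word cannot lie in both \<open>M\<close> and \<open>L\<close>, so
    runs with equal products are both over \<open>X\<close> or both over \<open>Z\<close>; unique
    decipherability of that code then makes them equal.\<close>
  have inj: "r = s" if r: "r \<in> set (runs ?P xs)" and s: "s \<in> set (runs ?P ys)"
    and rs: "concat r = concat s" for r s
  proof -
    have "t \<noteq> [] \<and> concat t \<noteq> [] \<and>
        (t \<in> lists X \<and> concat t \<in> M \<or> t \<in> lists Z \<and> concat t \<in> L)"
      if t: "t \<in> set (runs ?P zs)" and zs: "zs \<in> lists (X \<union> Z)" for t zs
    proof -
      have ne: "t \<noteq> []" and hd: "\<forall>y \<in> set t. y \<in> X \<longleftrightarrow> hd t \<in> X" and t': "t \<in> lists (X \<union> Z)"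
        using t in_lists[OF zs] runs_wrt_runs[of ?P zs] by (auto simp: runs_wrt_def)
      have "concat t \<noteq> []"
        using red[OF zs] imageI[OF t, of concat]
        by (simp add: reduced_form_def del: concat_eq_Nil_conv) metis
      moreover have "t \<in> lists X \<or> t \<in> lists Z"
        using hd t' by (cases "hd t \<in> X") auto
      ultimately show ?thesis
        using ne concat_in_submonoid[OF M, of t] concat_in_submonoid[OF L, of t] XM ZL by auto
    qed
    from this[OF r xs] this[OF s ys] show ?thesis
      using rs triv X(1) Z(1) unfolding ud_code_def by (metis IntI empty_iff insert_iff subsetD)
  qed
  have "runs ?P xs = runs ?P ys"
    using inj maps by (rule list.inj_map_strong)
  then show "xs = ys"
    by (metis concat_runs)
qed

text \<open>The length of a power of the nonempty word \<open>w\<close> determines its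
  exponent.\<close>

lemma ud_code_singleton:
  assumes "w \<in> lists A" and "w \<noteq> []"
  shows "ud_code A {w}"
  unfolding ud_code_def
proof (intro conjI ballI impI)
  show "code A {w}"
    using assms by (simp add: code_def)
  fix xs ys assume xs: "xs \<in> lists {w}" and ys: "ys \<in> lists {w}" and eq: "concat xs = concat ys"
  have rep: "zs = replicate (length zs) w" if "zs \<in> lists {w}" for zs
    using that by (induction zs) auto
  have "length (concat zs) = length zs * length w" if "zs \<in> lists {w}" for zs
    using that by (induction zs) auto
  with xs ys eq have "length xs = length ys"
    using assms(2) by (metis length_0_conv mult_right_cancel)
  then show "xs = ys"
    using rep[OF xs] rep[OF ys] by simp
qed

text \<open>The runs of the factorization of \<open>x\<close> over \<open>X \<union> Z\<close>
  provide a reduced form. Conversely, factoring each factor of a reduced form gives a run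
  decomposition of a factorization of \<open>x\<close>, and both the factorization and its runs are
  unique.\<close>

lemma is_free_product_if_ud_code_Un:
  assumes ud: "ud_code A (X \<union> Z)" and disj: "X \<inter> Z = {}"
  shows "is_free_product (word_monoid A) (gen_submonoid (word_monoid A) (X \<union> Z))
    (gen_submonoid (word_monoid A) X) (gen_submonoid (word_monoid A) Z)"
proof -
  let ?P = "\<lambda>y. y \<in> X"
  let ?M = "concat ` lists X" and ?L = "concat ` lists Z" and ?N = "concat ` lists (X \<union> Z)"
  have sub: "X \<subseteq> lists A" "Z \<subseteq> lists A" "X \<union> Z \<subseteq> lists A" and ne: "[] \<notin> X \<union> Z"
    using ud by (auto simp: ud_code_def code_def)
  have inj: "xs = ys"
    if "concat xs = concat ys" "xs \<in> lists (X \<union> Z)" "ys \<in> lists (X \<union> Z)" for xs ys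
    using ud that unfolding ud_code_def by blast
  note mon = sub[THEN submonoid_concat_lists]
  \<comment> \<open>A common element has a factorization over \<open>X\<close> and one over
    \<open>Z\<close>; these coincide, and disjointness leaves only the empty list.\<close>
  have triv: "?M \<inter> ?L \<subseteq> {[]}"
  proof
    fix m assume "m \<in> ?M \<inter> ?L"
    then obtain xs zs where xs: "xs \<in> lists X" "m = concat xs" and zs: "zs \<in> lists Z" "m = concat zs"
      by blast
    then have "xs = zs"
      by (intro inj) auto
    then have "xs = []"
      using xs(1) zs(1) disj by (cases xs) auto
    then show "m \<in> {[]}"
      using xs by simp
  qed
  have gen: "X \<subseteq> ?M - {[]}" "Z \<subseteq> ?L - {[]}"
    using ne by (auto intro!: image_eqI[of _ _ "[x]" for x])
  have "\<exists>!ms. reduced_form (word_monoid A) ?M ?L ms \<and> concat ms = x"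
    if x_in: "x \<in> ?N" for x
  proof -
    obtain ys where ys: "ys \<in> lists (X \<union> Z)" and x: "x = concat ys"
      using x_in by blast
    show ?thesis
    proof (rule ex1I[of _ "map concat (runs ?P ys)"], rule conjI)
      have "concat (runs ?P ys) \<in> lists (X \<union> Z)"
        using ys by simp
      then have "set (runs ?P ys) \<subseteq> lists (X \<union> Z)"
        by (auto simp del: concat_runs)
      with runs_wrt_runs show "reduced_form (word_monoid A) ?M ?L (map concat (runs ?P ys))"
        by (rule reduced_form_map_concat[OF mon(1,2) triv gen])
      show "concat (map concat (runs ?P ys)) = x"
        by (simp add: x concat_map_concat)
    next
      fix ms assume ms: "reduced_form (word_monoid A) ?M ?L ms \<and> concat ms = x"
      then have nil: "[] \<notin> set ms" and un: "set ms \<subseteq> ?M \<union> ?L"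
        and alt: "successively (\<lambda>x y. (x \<in> ?M) \<noteq> (y \<in> ?M)) ms"
        using triv by (simp_all add: reduced_form_iff)
      \<comment> \<open>Each factor is decomposed over \<open>X\<close> alone or over
        \<open>Z\<close> alone, so that its chosen factorization \<open>f m\<close> can serve as a
        single run.\<close>
      from un have "\<forall>m \<in> set ms. \<exists>r. (r \<in> lists X \<or> r \<in> lists Z) \<and> m = concat r"
        by blast
      then obtain f where f: "\<And>m. m \<in> set ms \<Longrightarrow> f m \<in> lists X \<or> f m \<in> lists Z"
        and concat_f: "\<And>m. m \<in> set ms \<Longrightarrow> concat (f m) = m"
        by metis
      have f_ne: "f m \<noteq> []" if "m \<in> set ms" for m
        using concat_f[OF that] nil that by auto
      \<comment> \<open>This turns the alternation of the factors into alternation of the lists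
        \<open>f m\<close>. A nonempty \<open>m\<close> factored over \<open>Z\<close> cannot also
        lie in \<open>?M\<close>, by \<open>triv\<close>.\<close>
      have hd_f: "hd (f m) \<in> X \<longleftrightarrow> m \<in> ?M" if m: "m \<in> set ms" for m
      proof -
        have "m \<notin> ?M" if "f m \<in> lists Z"
        proof -
          have "m \<in> ?L"
            using concat_f[OF m] that by (metis imageI)
          then show ?thesis
            using triv nil m by (metis IntI singletonD subsetD)
        qed
        moreover have "m \<in> ?M" if "f m \<in> lists X"
          using concat_f[OF m] that by (metis imageI)
        ultimately show ?thesis
          using f[OF m] hd_in_set[OF f_ne[OF m]] disj by auto
      qed
      have "runs_wrt ?P (map f ms)"
        unfolding runs_wrt_def
      proof (intro conjI ballI)
        show "[] \<notin> set (map f ms)"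
          using f_ne by force
        show "successively (\<lambda>r s. (hd r \<in> X) \<noteq> (hd s \<in> X)) (map f ms)"
          unfolding successively_map using alt
          by (rule successively_mono) (simp add: hd_f)
        fix r y assume r: "r \<in> set (map f ms)" and y: "y \<in> set r"
        have "hd r \<in> set r"
          using y by (cases r) auto
        moreover have "r \<in> lists X \<or> r \<in> lists Z"
          using r f by auto
        ultimately show "y \<in> X \<longleftrightarrow> hd r \<in> X"
          using y disj by (auto dest!: in_listsD)
      qed
      then have "runs ?P (concat (map f ms)) = map f ms"
        by (rule runs_concat)
      \<comment> \<open>Both sides are factorizations of \<open>x\<close> over
        \<open>X \<union> Z\<close>, so unique decipherability applies.\<close>
      moreover have "concat (map f ms) = ys"
      proof (rule inj)
        have "\<forall>m \<in> set ms. f m \<in> lists (X \<union> Z)"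
        proof
          fix m assume "m \<in> set ms"
          then show "f m \<in> lists (X \<union> Z)"
            using f[of m] by auto
        qed
        then show "concat (map f ms) \<in> lists (X \<union> Z)"
          unfolding in_lists_conv_set by simp
        have "concat (concat (map f ms)) = concat (map concat (map f ms))"
          by (rule concat_map_concat [symmetric])
        also have "map concat (map f ms) = ms"
          using concat_f by (simp add: map_idI)
        finally show "concat (concat (map f ms)) = concat ys"
          using ms x by simp
      qed (rule ys)
      ultimately show "ms = map concat (runs ?P ys)"
        using concat_f by (simp add: map_idI)
    qed
  qed
  moreover have "?N = gen_submonoid (word_monoid A) (?M \<union> ?L)"
    using gen_submonoid_Un[of "word_monoid A" X Z] sub by (simp add: gen_submonoid_word_monoid)
  ultimately show ?thesis
    using mon sub by (simp add: is_free_product_def gen_submonoid_word_monoid)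
qed

section \<open>Maximality of the code and fullness of its submonoid\<close>

text \<open>A nonempty word \<open>l\<close> of a free complement \<open>L\<close> lies outside
  \<open>X\<close>, because the two factors meet trivially, and adjoining it would give a larger
  uniquely decipherable code. So every free complement is trivial.\<close>

lemma full_submonoid_if_maximal_ud_code:
  assumes max: "maximal_ud_code A X"
  shows "full_submonoid (word_monoid A) (gen_submonoid (word_monoid A) X)"
proof -
  let ?G = "word_monoid A"
  have ud: "ud_code A X"
    using max by (simp add: maximal_ud_code_def)
  then have "X \<subseteq> lists A"
    by (auto simp: ud_code_def code_def)
  then have subM: "submonoid (gen_submonoid ?G X) ?G"
    by (simp add: gen_submonoid_word_monoid submonoid_concat_lists)
  have XM: "X \<subseteq> gen_submonoid ?G X"
    unfolding gen_submonoid_def by (rule hull_subset)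
  show ?thesis
    unfolding full_submonoid_def free_factor_def
  proof (intro conjI allI impI)
    fix N assume "submonoid N ?G \<and> (\<exists>L. is_free_product ?G N (gen_submonoid ?G X) L)"
    then obtain L where free: "is_free_product ?G N (gen_submonoid ?G X) L"
      by blast
    then have L: "submonoid L ?G" and N: "N = gen_submonoid ?G (gen_submonoid ?G X \<union> L)"
      by (auto simp: is_free_product_def)
    have "L \<subseteq> {[]}"
    proof
      fix l assume "l \<in> L"
      show "l \<in> {[]}"
      proof (rule ccontr)
        assume "l \<notin> {[]}"
        then have "l \<notin> X"
          using is_free_product_Int[OF free] XM \<open>l \<in> L\<close> by blast
        have "ud_code A {l}"
          using L \<open>l \<in> L\<close> \<open>l \<notin> {[]}\<close>
          by (intro ud_code_singleton) (auto simp: submonoid_word_monoid_iff)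
        then have "ud_code A (X \<union> {l})"
          using \<open>l \<in> L\<close> by (intro ud_code_Un[OF free ud XM]) auto
        with max \<open>l \<notin> X\<close> show False
          unfolding maximal_ud_code_def by blast
      qed
    qed
    then have "gen_submonoid ?G X \<union> L = gen_submonoid ?G X"
      using subM by (auto simp: submonoid_word_monoid_iff)
    then show "N = gen_submonoid ?G X"
      using subM unfolding N gen_submonoid_def by (simp add: hull_same)
  qed (rule subM)
qed

text \<open>If \<open>Y\<close> properly extends \<open>X\<close>, fullness forces both to generate
  the same submonoid. A word \<open>y\<close> of \<open>Y - X\<close> then has a factorization over
  \<open>X\<close> besides \<open>[y]\<close>, which contradicts unique decipherability of
  \<open>Y\<close>.\<close>

lemma maximal_ud_code_if_full_submonoid:
  assumes ud: "ud_code A X"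
    and full: "full_submonoid (word_monoid A) (gen_submonoid (word_monoid A) X)"
  shows "maximal_ud_code A X"
  unfolding maximal_ud_code_def
proof (intro conjI notI)
  assume "\<exists>Y. ud_code A Y \<and> X \<subset> Y"
  then obtain Y y where Y: "ud_code A Y" "X \<subset> Y" and y: "y \<in> Y" "y \<notin> X"
    by blast
  have "X \<subseteq> lists A"
    using ud by (auto simp: ud_code_def code_def)
  define Z where "Z = Y - X"
  have YZ: "Y = X \<union> Z" and disj: "X \<inter> Z = {}"
    using Y(2) by (auto simp: Z_def)
  have "is_free_product (word_monoid A) (gen_submonoid (word_monoid A) Y)
      (gen_submonoid (word_monoid A) X) (gen_submonoid (word_monoid A) Z)"
    using Y(1) unfolding YZ by (rule is_free_product_if_ud_code_Un) (rule disj)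
  then have "gen_submonoid (word_monoid A) Y = gen_submonoid (word_monoid A) X"
    using full unfolding full_submonoid_def free_factor_def is_free_product_def by blast
  moreover have "y \<in> gen_submonoid (word_monoid A) Y"
    unfolding gen_submonoid_def using y(1) by (rule hull_inc)
  ultimately obtain xs where xs: "xs \<in> lists X" "y = concat xs"
    using \<open>X \<subseteq> lists A\<close> by (auto simp: gen_submonoid_word_monoid)
  have "[y] \<in> lists Y" "xs \<in> lists Y"
    using xs(1) y(1) Y(2) by auto
  then have "[y] = xs"
    using Y(1) xs(2) unfolding ud_code_def by (metis concat.simps append_Nil2)
  then show False
    using xs(1) y(2) by auto
qed (rule ud)

theorem theorem4p11:
  fixes A :: "'a set" and X :: "'a list set"
  assumes "ud_code A X"
  shows "maximal_ud_code A X \<longleftrightarrow>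
    full_submonoid (word_monoid A) (gen_submonoid (word_monoid A) X)"
  using assms full_submonoid_if_maximal_ud_code maximal_ud_code_if_full_submonoid by blast

end
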